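(* For every integer $k\ge 1$, $\mathrm{Duck}_{k,1}=tb_{k-1}$, where $tb_{k-1}$ is the $(k-1)$-st weighted tennis ball number.
   Context: A 3D-Dyck word of length $3k$ is a word with $k$ letters X, $k$ letters Y and $k$ letters Z such that in every prefix the number of X's is at least the number of Y's, which is at least the number of Z's. $\mathrm{Duck}_{k,i}$ is the number of 3D-Dyck words of length $3k$ in which exactly $i$ of the Y's do not have an X immediately before them. Tennis ball process with $m$ rounds: start with an empty room and an empty lawn. In round $r=1,\dots,m$, put the balls numbered $2r-1$ and $2r$ into the room, then choose any one ball currently in the room and throw it onto the lawn. $TB_m$ is the set of all possible configurations of balls on the lawn after $m$ rounds, where a configuration is the set ($m$-element subset of $\{1,\dots,2m\}$) of numbers of the balls on the lawn, irrespective of the order in which they were thrown. The $m$-th weighted tennis ball number is $tb_m=\sum_{a\in TB_m}\sum_{b\in a} b$. (For $m=0$: $TB_0=\{\emptyset\}$ and $tb_0=0$.) *)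

theory Defs
  imports Main
begin

datatype letter = X | Y | Z

definition dyck3d_words :: "nat \<Rightarrow> letter list set" where
  "dyck3d_words k = {w.
     count_list w X = k \<and> count_list w Y = k \<and> count_list w Z = k \<and>
     (\<forall>n \<le> length w.
        count_list (take n w) Y \<le> count_list (take n w) X \<and>
        count_list (take n w) Z \<le> count_list (take n w) Y)}"

(* A Y in the very first position has no letter before it, hence counts as
   not having an X immediately before it. *)
definition Y_without_X_before :: "letter list \<Rightarrow> nat" where
  "Y_without_X_before w =
     card {j. j < length w \<and> w ! j = Y \<and> \<not> (j > 0 \<and> w ! (j - 1) = X)}"

definition Duck :: "nat \<Rightarrow> nat \<Rightarrow> nat" where
  "Duck k i = card {w \<in> dyck3d_words k. Y_without_X_before w = i}"

(* tennis m R L: after m rounds it is possible that the balls in the room are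
   exactly those in R and the balls on the lawn exactly those in L.
   Round r = Suc m brings in the balls 2r-1 = 2m+1 and 2r = 2m+2. *)
inductive tennis :: "nat \<Rightarrow> nat set \<Rightarrow> nat set \<Rightarrow> bool" where
  start: "tennis 0 {} {}"
| round: "tennis m R L \<Longrightarrow> b \<in> R \<union> {2 * m + 1, 2 * m + 2} \<Longrightarrow>
    tennis (Suc m) (R \<union> {2 * m + 1, 2 * m + 2} - {b}) (insert b L)"

definition TB :: "nat \<Rightarrow> nat set set" where
  "TB m = {L. \<exists>R. tennis m R L}"

definition tb :: "nat \<Rightarrow> nat" where
  "tb m = (\<Sum>a\<in>TB m. \<Sum>b\<in>a. b)"

(* The sets whose cardinalities and sums are taken above are finite. *)

lemma finite_dyck3d_words: "finite (dyck3d_words k)"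
proof -
  have len: "length w = count_list w X + count_list w Y + count_list w Z" for w
  proof (induction w)
    case (Cons a w)
    then show ?case by (cases a) auto
  qed simp
  have univ: "(UNIV :: letter set) = {X, Y, Z}"
    using letter.exhaust by blast
  have "dyck3d_words k \<subseteq> {w. set w \<subseteq> {X, Y, Z} \<and> length w = 3 * k}"
    unfolding univ[symmetric] by (auto simp: dyck3d_words_def len)
  moreover have "finite {w. set w \<subseteq> {X, Y, Z} \<and> length w = 3 * k}"
    by (rule finite_lists_length_eq) simp
  ultimately show ?thesis
    by (rule finite_subset)
qed

lemma tennis_bounds:
  "tennis m R L \<Longrightarrow> R \<inter> L = {} \<and> R \<union> L = {1..2 * m} \<and> card L = m"
proof (induction rule: tennis.induct)
  case (round m R L b)
  let ?N = "{2 * m + 1, 2 * m + 2}"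
  have L: "finite L" "L \<subseteq> {1..2 * m}"
    using round.IH finite_subset[of L "{1..2 * m}"] by auto
  have "?N \<inter> L = {}"
    using L(2) by auto
  then have disj: "(R \<union> ?N) \<inter> L = {}"
    using round.IH by blast
  then have b: "b \<notin> L"
    using round.hyps by blast
  have "{1..2 * Suc m} = {1..2 * m} \<union> ?N"
    by auto
  also have "\<dots> = (R \<union> ?N - {b}) \<union> insert b L"
    using round by blast
  finally have "(R \<union> ?N - {b}) \<union> insert b L = {1..2 * Suc m}" ..
  moreover have "(R \<union> ?N - {b}) \<inter> insert b L = {}"
    using disj by blast
  moreover have "card (insert b L) = Suc m"
    using b L(1) round.IH by simp
  ultimately show ?case
    by blast
qed simp

lemma TB_element:
  assumes "a \<in> TB m"
  shows "a \<subseteq> {1..2 * m}" "card a = m"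
proof -
  obtain R where "tennis m R a"
    using assms unfolding TB_def by blast
  from tennis_bounds[OF this] show "a \<subseteq> {1..2 * m}" "card a = m"
    by blast+
qed

lemma finite_TB: "finite (TB m)"
proof (rule finite_subset)
  show "TB m \<subseteq> Pow {1..2 * m}"
    using TB_element(1) by blast
qed simp

end

theory Submission
  imports Defs
begin

text \<open>
  Contract each factor XY of a 3D-Dyck word counted by \<open>Duck k 1\<close> to an up step and turn each Z
  into a down step. One X and one Y remain uncontracted; the X precedes the Y and is not adjacent
  to it. Reading the remaining Y as an up step gives a Dyck path of semilength \<open>k\<close> with one
  distinguished up step, and if this step has (zero-based) position \<open>j\<close>, then there are exactly
  \<open>j\<close> places for the remaining X. So \<open>Duck k 1\<close> is the sum of the positions of all up steps of all
  Dyck paths. The up steps at positive positions form exactly the lawn configurations after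
  \<open>k - 1\<close> rounds, since a set is such a configuration iff at least \<open>r\<close> of its balls
  come from the first \<open>r\<close> rounds, for every \<open>r\<close>.
\<close>

section \<open>Contraction of the factors XY\<close>

text \<open>Occurrences of XY cannot overlap, so the greedy scan finds all of them. Blocks stay
  lists of letters so that \<open>concat\<close> undoes the contraction.\<close>

fun contract :: "letter list \<Rightarrow> letter list list" where
  "contract (X # Y # w) = [X, Y] # contract w"
| "contract (a # w) = [a] # contract w"
| "contract [] = []"

fun step_word :: "bool \<Rightarrow> letter list" where
  "step_word True = [X, Y]"
| "step_word False = [Z]"

definition path_word :: "bool list \<Rightarrow> letter list" where
  "path_word p = concat (map step_word p)"

lemma path_word_simps [simp]:
  "path_word [] = []"
  "path_word (True # p) = X # Y # path_word p"
  "path_word (False # p) = Z # path_word p"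
  by (simp_all add: path_word_def)

lemma inj_step_word: "inj step_word"
proof (rule injI)
  show "a = b" if "step_word a = step_word b" for a b
    using that by (cases a; cases b) auto
qed

lemma step_word_neq [simp]: "step_word a \<noteq> [X]" "step_word a \<noteq> [Y]"
    "[X] \<noteq> step_word a" "[Y] \<noteq> step_word a"
  by (cases a; simp)+

lemma concat_contract: "concat (contract w) = w"
  by (induction w rule: contract.induct) auto

lemma set_contract: "set (contract w) \<subseteq> {[X, Y], [X], [Y], [Z]}"
proof -
  have "[a] \<in> {[X], [Y], [Z]}" for a
    by (cases a) auto
  then show ?thesis
    by (induction w rule: contract.induct) auto
qed

lemma contract_path_word_append:
  "contract (path_word p @ w) = map step_word p @ contract w"
proof (induction p)
  case (Cons a p)
  then show ?case by (cases a) auto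
qed simp

lemma contract_path_word: "contract (path_word p) = map step_word p"
  using contract_path_word_append[of p "[]"] by simp

text \<open>A nonempty \<open>v\<close> makes the word after the leading X start with X or Z, so
  this X is not absorbed into a block XY.\<close>

lemma contract_X_path_word_append:
  assumes "v \<noteq> []"
  shows "contract (X # path_word v @ w) = [X] # map step_word v @ contract w"
proof (cases v)
  case (Cons a v')
  then show ?thesis
    using contract_path_word_append[of v w] by (cases a) auto
qed (use assms in simp)

lemma map_step_word_exists:
  assumes "set ts \<subseteq> {[X, Y], [Z]}"
  shows "\<exists>p. ts = map step_word p"
proof -
  have "{[X, Y], [Z]} = range step_word"
    by (auto simp: UNIV_bool)
  then show ?thesis
    unfolding ex_map_conv using assms by blast
qed

text \<open>In the excluded case the head Y of \<open>w\<close> would stop being counted once the X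
  stands in front of it; otherwise all positions of \<open>w\<close> keep their status.\<close>

lemma Y_without_X_before_Cons:
  assumes "\<not> (a = X \<and> w \<noteq> [] \<and> hd w = Y)"
  shows "Y_without_X_before (a # w) = (if a = Y then 1 else 0) + Y_without_X_before w"
proof -
  let ?S = "\<lambda>w. {j. j < length w \<and> w ! j = Y \<and> \<not> (j > 0 \<and> w ! (j - 1) = X)}"
  have "j \<in> ?S (a # w) \<longleftrightarrow> j \<in> (if a = Y then {0} else {}) \<union> Suc ` ?S w" for j
  proof (cases j)
    case (Suc i)
    then show ?thesis
      using assms by (cases i) (auto simp: hd_conv_nth)
  qed auto
  then have "?S (a # w) = (if a = Y then {0} else {}) \<union> Suc ` ?S w"
    by blast
  then have "card (?S (a # w)) = card (if a = Y then {0::nat} else {}) + card (Suc ` ?S w)"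
    by (auto simp: card_insert_if)
  then show ?thesis
    by (simp add: Y_without_X_before_def card_image)
qed

lemma Y_without_X_before_XY:
  "Y_without_X_before (X # Y # w) = Y_without_X_before w"
proof -
  let ?S = "\<lambda>w. {j. j < length w \<and> w ! j = Y \<and> \<not> (j > 0 \<and> w ! (j - 1) = X)}"
  have "j \<in> ?S (X # Y # w) \<longleftrightarrow> j \<in> (\<lambda>i. Suc (Suc i)) ` ?S w" for j
  proof (cases j)
    case (Suc i)
    then show ?thesis
    proof (cases i)
      case (Suc i')
      then show ?thesis
        using \<open>j = Suc i\<close> by (cases i') auto
    qed auto
  qed auto
  then have "?S (X # Y # w) = (\<lambda>i. Suc (Suc i)) ` ?S w"
    by blast
  then show ?thesis
    by (simp add: Y_without_X_before_def card_image inj_on_def)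
qed

text \<open>A Y with an X just before it always lies in a block XY, so the counted Ys are the
  singleton blocks.\<close>

lemma Y_without_X_before_contract:
  "Y_without_X_before w = count_list (contract w) [Y]"
proof (induction w rule: contract.induct)
  case (1 w)
  then show ?case by (simp add: Y_without_X_before_XY)
next
  case ("2_3" v)
  then show ?case by (simp add: Y_without_X_before_Cons)
qed (simp_all add: Y_without_X_before_Cons, simp add: Y_without_X_before_def)

lemma count_list_contract:
  "count_list w X = count_list (contract w) [X, Y] + count_list (contract w) [X] \<and>
   count_list w Y = count_list (contract w) [X, Y] + count_list (contract w) [Y]"
  by (induction w rule: contract.induct) simp_all

lemma count_list_path_word [simp]:
  "count_list (path_word p) X = count_list p True"
  "count_list (path_word p) Y = count_list p True"
  "count_list (path_word p) Z = count_list p False"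
proof (induction p)
  case (Cons a p)
  case 1 show ?case using Cons by (cases a) auto
  case 2 show ?case using Cons by (cases a) auto
  case 3 show ?case using Cons by (cases a) auto
qed simp_all

section \<open>Prefix conditions\<close>

text \<open>Here \<open>a\<close> and \<open>b\<close> are the current surpluses of X over Y and of Y over Z.\<close>

fun balanced :: "nat \<Rightarrow> nat \<Rightarrow> letter list \<Rightarrow> bool" where
  "balanced a b [] = True"
| "balanced a b (X # w) = balanced (Suc a) b w"
| "balanced a b (Y # w) = (a > 0 \<and> balanced (a - 1) (Suc b) w)"
| "balanced a b (Z # w) = (b > 0 \<and> balanced a (b - 1) w)"

fun nonneg_path :: "nat \<Rightarrow> bool list \<Rightarrow> bool" where
  "nonneg_path b [] = True"
| "nonneg_path b (True # p) = nonneg_path (Suc b) p"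
| "nonneg_path b (False # p) = (b > 0 \<and> nonneg_path (b - 1) p)"

lemma all_le_Suc_iff: "(\<forall>n\<le>Suc m. P n) \<longleftrightarrow> P 0 \<and> (\<forall>n\<le>m. P (Suc n))"
  by (metis Suc_le_mono le0 old.nat.exhaust)

lemma balanced_iff:
  "balanced a b w \<longleftrightarrow> (\<forall>n\<le>length w.
     count_list (take n w) Y \<le> a + count_list (take n w) X \<and>
     count_list (take n w) Z \<le> b + count_list (take n w) Y)"
proof (induction a b w rule: balanced.induct)
  case (3 a b w)
  show ?case
  proof (cases a)
    case 0
    then show ?thesis by (auto simp: all_le_Suc_iff intro!: exI[of _ 0])
  qed (use 3 in \<open>simp add: all_le_Suc_iff\<close>)
next
  case (4 a b w)
  show ?case
  proof (cases b)
    case 0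
    then show ?thesis by (auto simp: all_le_Suc_iff intro!: exI[of _ 0])
  qed (use 4 in \<open>simp add: all_le_Suc_iff\<close>)
qed (simp_all add: all_le_Suc_iff)

lemma nonneg_path_iff:
  "nonneg_path b p \<longleftrightarrow>
     (\<forall>n\<le>length p. count_list (take n p) False \<le> b + count_list (take n p) True)"
proof (induction b p rule: nonneg_path.induct)
  case (3 b p)
  show ?case
  proof (cases b)
    case 0
    then show ?thesis by (auto simp: all_le_Suc_iff intro!: exI[of _ 0])
  qed (use 3 in \<open>simp add: all_le_Suc_iff\<close>)
qed (simp_all add: all_le_Suc_iff)

text \<open>A block XY restores the surplus of X over Y and raises that of Y over Z by one; a Z
  lowers the latter. At block ends only \<open>b\<close> has changed, and it is the height of the
  path.\<close>

lemma balanced_path_word: "balanced a b (path_word p) \<longleftrightarrow> nonneg_path b p"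
  by (induction b p rule: nonneg_path.induct) auto

lemma balanced_path_word_Y:
  "balanced (Suc a) b (path_word v @ Y # path_word t) \<longleftrightarrow> nonneg_path b (v @ True # t)"
  by (induction b v rule: nonneg_path.induct) (auto simp: balanced_path_word)

text \<open>The extra X leaves the height \<open>b\<close> unchanged and supplies the surplus that
  the extra Y uses up. Hence this Y acts as an up step, wherever before it the X stands.\<close>

lemma balanced_path_word_X_Y:
  "balanced a b (path_word u @ X # path_word v @ Y # path_word t) \<longleftrightarrow>
     nonneg_path b (u @ v @ True # t)"
  by (induction b u rule: nonneg_path.induct) (auto simp: balanced_path_word_Y)

text \<open>After complete blocks the surplus of X over Y is zero again, which forbids a lone Y.
  This will force the lone X of a word to precede its lone Y.\<close>

lemma not_balanced_path_word_Y: "\<not> balanced 0 b (path_word u @ Y # w)"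
  by (induction b u rule: nonneg_path.induct) auto

lemma dyck3d_words_iff:
  "w \<in> dyck3d_words k \<longleftrightarrow>
     count_list w X = k \<and> count_list w Y = k \<and> count_list w Z = k \<and> balanced 0 0 w"
  by (simp add: dyck3d_words_def balanced_iff)

section \<open>Words with a single Y not after X\<close>

definition dyck_paths :: "nat \<Rightarrow> bool list set" where
  "dyck_paths k = {p. count_list p True = k \<and> count_list p False = k \<and> nonneg_path 0 p}"

text \<open>The lone X belongs between \<open>u\<close> and \<open>v\<close>, and the displayed
  \<open>True\<close> stands for the lone Y. A nonempty \<open>v\<close> keeps the two from forming
  a block XY.\<close>

definition split_paths :: "nat \<Rightarrow> (bool list \<times> bool list \<times> bool list) set" where
  "split_paths k = {(u, v, t). v \<noteq> [] \<and> u @ v @ True # t \<in> dyck_paths k}"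

definition split_word :: "bool list \<times> bool list \<times> bool list \<Rightarrow> letter list" where
  "split_word = (\<lambda>(u, v, t). path_word u @ X # path_word v @ Y # path_word t)"

lemma contract_split_word:
  assumes "v \<noteq> []"
  shows "contract (split_word (u, v, t)) =
    map step_word u @ [X] # map step_word v @ [Y] # map step_word t"
  using assms
  by (simp add: split_word_def contract_path_word_append contract_X_path_word_append
      contract_path_word)

text \<open>In the contracted word the blocks \<open>[X]\<close> and \<open>[Y]\<close> occur once
  each, so they mark the cuts between the three parts.\<close>

lemma inj_on_split_word: "inj_on split_word (split_paths k)"
proof (rule inj_onI)
  fix x y
  assume xy: "x \<in> split_paths k" "y \<in> split_paths k" "split_word x = split_word y"
  obtain u v t u' v' t' where eq: "x = (u, v, t)" "y = (u', v', t')"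
    by (cases x; cases y)
  then have "v \<noteq> []" "v' \<noteq> []"
    using xy by (auto simp: split_paths_def)
  then have e: "map step_word u @ [X] # map step_word v @ [Y] # map step_word t =
      map step_word u' @ [X] # map step_word v' @ [Y] # map step_word t'"
    using xy(3) eq by (metis contract_split_word)
  have "map step_word u = map step_word u' \<and>
      map step_word v @ [Y] # map step_word t = map step_word v' @ [Y] # map step_word t'"
    using e by (subst (asm) append_Cons_eq_iff) auto
  moreover from this have
      "map step_word v = map step_word v' \<and> map step_word t = map step_word t'"
    by (subst (asm) append_Cons_eq_iff) auto
  ultimately show "x = y"
    using eq inj_step_word by (simp add: inj_map_eq_map)
qed

lemma count_list_map_step_word [simp]:
  "count_list (map step_word p) [X] = 0" "count_list (map step_word p) [Y] = 0"
  by (auto simp: count_list_0_iff)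

lemma split_word_image:
  "split_word ` split_paths k = {w \<in> dyck3d_words k. Y_without_X_before w = 1}"
proof (intro equalityI subsetI)
  fix w
  assume "w \<in> split_word ` split_paths k"
  then obtain u v t where w: "w = split_word (u, v, t)" "v \<noteq> []"
      "u @ v @ True # t \<in> dyck_paths k"
    by (auto simp: split_paths_def)
  have "Y_without_X_before w = 1"
    using w by (simp add: Y_without_X_before_contract contract_split_word)
  moreover have "w \<in> dyck3d_words k"
    using w(3) unfolding dyck3d_words_iff w(1) split_word_def
    by (auto simp: dyck_paths_def balanced_path_word_X_Y)
  ultimately show "w \<in> {w \<in> dyck3d_words k. Y_without_X_before w = 1}"
    by simp
next
  fix w
  assume "w \<in> {w \<in> dyck3d_words k. Y_without_X_before w = 1}"
  then have w: "w \<in> dyck3d_words k" and Y1: "count_list (contract w) [Y] = 1"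
    by (auto simp: Y_without_X_before_contract)
  \<comment> \<open>Each block XY has one X and one Y, so equal totals of X and Y force equally many
    lone Xs and lone Ys.\<close>
  have X1: "count_list (contract w) [X] = 1"
    using w Y1 count_list_contract[of w] by (simp add: dyck3d_words_iff)
  have bal: "balanced 0 0 w"
    using w by (simp add: dyck3d_words_iff)
  have "[Y] \<in> set (contract w)"
    using Y1 by (metis count_list_0_iff zero_neq_one)
  then obtain us ts where split1: "contract w = us @ [Y] # ts" and "[Y] \<notin> set us"
    by (metis split_list_first)
  then have notY: "[Y] \<notin> set us" "[Y] \<notin> set ts"
    using Y1 by (auto simp: count_list_0_iff)
  have "[X] \<in> set us"
  proof (rule ccontr)
    assume "[X] \<notin> set us"
    then have "set us \<subseteq> {[X, Y], [Z]}"
      using set_contract[of w] split1 notY by auto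
    then obtain p where "us = map step_word p"
      using map_step_word_exists by blast
    then have "w = path_word p @ Y # concat ts"
      using concat_contract[of w] split1 by (simp add: path_word_def)
    then show False
      using bal not_balanced_path_word_Y by simp
  qed
  then obtain us' vs where us: "us = us' @ [X] # vs"
    by (metis split_list)
  have notX: "[X] \<notin> set us'" "[X] \<notin> set vs" "[X] \<notin> set ts"
    using X1 split1 us by (auto simp: count_list_0_iff)
  have "set us' \<subseteq> {[X, Y], [Z]}" "set vs \<subseteq> {[X, Y], [Z]}" "set ts \<subseteq> {[X, Y], [Z]}"
    using set_contract[of w] split1 us notX notY by auto
  then obtain u v t where uvt: "us' = map step_word u" "vs = map step_word v"
      "ts = map step_word t"
    using map_step_word_exists by meson
  have weq: "w = split_word (u, v, t)"
    using concat_contract[of w] split1 us uvt by (simp add: path_word_def split_word_def)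
  \<comment> \<open>Otherwise the lone X and Y would be adjacent and contracted to one
    block.\<close>
  have "v \<noteq> []"
  proof
    assume "v = []"
    then have "contract w = map step_word u @ [X, Y] # contract (path_word t)"
      using weq by (simp add: split_word_def contract_path_word_append)
    then show False
      using split1 us uvt by simp
  qed
  moreover have "u @ v @ True # t \<in> dyck_paths k"
    using w unfolding dyck3d_words_iff weq split_word_def
    by (auto simp: dyck_paths_def balanced_path_word_X_Y)
  ultimately show "w \<in> split_word ` split_paths k"
    unfolding weq split_paths_def by blast
qed

section \<open>Counting the marked paths by positions of up steps\<close>

definition ups :: "bool list \<Rightarrow> nat set" where
  "ups p = {j. j < length p \<and> p ! j}"

lemma finite_ups [simp]: "finite (ups p)"
  by (simp add: ups_def)

lemma length_dyck_path:
  assumes "p \<in> dyck_paths k"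
  shows "length p = 2 * k"
proof -
  have "length p = count_list p True + count_list p False"
    by (induction p) auto
  then show ?thesis
    using assms by (simp add: dyck_paths_def)
qed

lemma finite_dyck_paths: "finite (dyck_paths k)"
proof (rule finite_subset)
  show "dyck_paths k \<subseteq> {p. set p \<subseteq> UNIV \<and> length p = 2 * k}"
    using length_dyck_path by auto
  show "finite {p :: bool list. set p \<subseteq> UNIV \<and> length p = 2 * k}"
    by (rule finite_lists_length_eq) simp
qed

text \<open>With the marked up step at \<open>j\<close>, the cut \<open>i = length u\<close> takes
  every value below \<open>j\<close>, strictly since \<open>v\<close> is nonempty. Hence each up
  step contributes its position.\<close>

lemma card_split_paths: "card (split_paths k) = (\<Sum>p\<in>dyck_paths k. \<Sum>j\<in>ups p. j)"
proof -
  let ?M = "SIGMA p:dyck_paths k. SIGMA j:ups p. {..<j}"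
  let ?f = "\<lambda>(u, v, t). (u @ v @ True # t, length u + length v, length u)"
  let ?g = "\<lambda>(p, j, i). (take i p, take (j - i) (drop i p), drop (Suc j) p)"
  have gf: "take i p @ take (j - i) (drop i p) @ True # drop (Suc j) p = p"
    if "j \<in> ups p" "i < j" for p i j
  proof -
    have "take (j - i) (drop i p) @ True # drop (Suc j) p = drop i p"
      using that by (metis (mono_tags, lifting) Cons_nth_drop_Suc add_diff_cancel_left'
          append_take_drop_id drop_drop le_add_diff_inverse2 less_imp_le mem_Collect_eq ups_def)
    then show ?thesis
      by simp
  qed
  have "bij_betw ?f (split_paths k) ?M"
  proof (rule bij_betw_byWitness[where f' = ?g])
    show "\<forall>x\<in>split_paths k. ?g (?f x) = x"
      by auto
    show "\<forall>x\<in>?M. ?f (?g x) = x"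
      using gf by (auto simp: ups_def)
    show "?f ` split_paths k \<subseteq> ?M"
      by (auto simp: split_paths_def ups_def nth_append)
    show "?g ` ?M \<subseteq> split_paths k"
      using gf by (auto simp: split_paths_def) (auto simp: ups_def)
  qed
  then have "card (split_paths k) = card ?M"
    by (rule bij_betw_same_card)
  also have "\<dots> = (\<Sum>p\<in>dyck_paths k. \<Sum>j\<in>ups p. j)"
    by (simp add: finite_dyck_paths)
  finally show ?thesis .
qed

lemma Duck_1_eq: "Duck k 1 = (\<Sum>p\<in>dyck_paths k. \<Sum>j\<in>ups p. j)"
  unfolding Duck_def split_word_image[symmetric]
  by (simp add: card_image inj_on_split_word card_split_paths)

section \<open>Dyck paths and lawn configurations\<close>

lemma count_list_True_take:
  "n \<le> length p \<Longrightarrow> count_list (take n p) True = card (ups p \<inter> {..<n})"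
proof (induction n)
  case (Suc n)
  then have "ups p \<inter> {..<Suc n} = (if p ! n then {n} else {}) \<union> (ups p \<inter> {..<n})"
    by (auto simp: ups_def less_Suc_eq)
  with Suc show ?case
    by (auto simp: take_Suc_conv_app_nth)
qed simp

lemma count_list_True_False: "count_list p True + count_list p False = length p"
  by (induction p) auto

text \<open>A prefix of length \<open>n\<close> with \<open>c\<close> up steps has
  \<open>n - c\<close> down steps, so staying nonnegative means
  \<open>n \<le> 2 * c\<close>.\<close>

lemma dyck_paths_iff:
  "p \<in> dyck_paths k \<longleftrightarrow> length p = 2 * k \<and> card (ups p) = k \<and>
     (\<forall>n\<le>2 * k. n \<le> 2 * card (ups p \<inter> {..<n}))"
proof -
  have "count_list p True = card (ups p)"
    using count_list_True_take[of "length p" p] by (simp add: Int_absorb2 ups_def subset_iff)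
  moreover have "count_list (take n p) False \<le> count_list (take n p) True \<longleftrightarrow>
      n \<le> 2 * card (ups p \<inter> {..<n})" if "n \<le> length p" for n
    using count_list_True_False[of "take n p"] count_list_True_take[OF that] that by auto
  ultimately show ?thesis
    using count_list_True_False[of p] by (auto simp: dyck_paths_def nonneg_path_iff)
qed

section \<open>Characterisation of the lawn configurations\<close>

definition lawn_sets :: "nat \<Rightarrow> nat set set" where
  "lawn_sets m = {L. L \<subseteq> {1..2 * m} \<and> card L = m \<and> (\<forall>r\<le>m. r \<le> card (L \<inter> {1..2 * r}))}"

text \<open>For \<open>r \<le> m\<close> a further ball cannot lower the counts; for
  \<open>r = Suc m\<close> every ball on the lawn has a number at most
  \<open>2 * Suc m\<close>.\<close>

lemma tennis_imp_lawn_sets: "tennis m R L \<Longrightarrow> L \<in> lawn_sets m"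
proof (induction rule: tennis.induct)
  case start
  then show ?case by (simp add: lawn_sets_def)
next
  case (round m R L b)
  note t = tennis_bounds[OF tennis.round[OF round.hyps]]
  have "r \<le> card (insert b L \<inter> {1..2 * r})" if "r \<le> Suc m" for r
  proof (cases "r = Suc m")
    case True
    have "insert b L \<inter> {1..2 * Suc m} = insert b L"
      using t by blast
    then show ?thesis
      using t True by simp
  next
    case False
    then have "r \<le> card (L \<inter> {1..2 * r})"
      using round.IH that by (simp add: lawn_sets_def)
    also have "\<dots> \<le> card (insert b L \<inter> {1..2 * r})"
      by (rule card_mono) auto
    finally show ?thesis .
  qed
  moreover have "insert b L \<subseteq> {1..2 * Suc m}" "card (insert b L) = Suc m"
    using t by blast+
  ultimately show ?case
    unfolding lawn_sets_def by blast
qed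

text \<open>In the last round, throw the largest ball of the configuration.\<close>

lemma lawn_sets_imp_tennis: "L \<in> lawn_sets m \<Longrightarrow> tennis m ({1..2 * m} - L) L"
proof (induction m arbitrary: L)
  case 0
  then show ?case by (auto simp: lawn_sets_def intro: tennis.start)
next
  case (Suc m)
  then have L: "L \<subseteq> {1..2 * Suc m}" "card L = Suc m"
    and r: "\<And>r. r \<le> Suc m \<Longrightarrow> r \<le> card (L \<inter> {1..2 * r})"
    by (auto simp: lawn_sets_def)
  have fin: "finite L"
    using L(1) finite_subset by blast
  have "L \<noteq> {}"
    using L(2) by auto
  define b where "b = Max L"
  define L' where "L' = L - {b}"
  have b: "b \<in> L" "\<And>x. x \<in> L \<Longrightarrow> x \<le> b"
    using fin \<open>L \<noteq> {}\<close> by (auto simp: b_def)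
  have cL': "card L' = m"
    using b(1) fin L(2) by (simp add: L'_def)
  \<comment> \<open>Removing the maximum \<open>b\<close> affects only initial segments that contain
    \<open>b\<close>, and these contain all \<open>m\<close> elements of \<open>L'\<close>.\<close>
  have low: "r \<le> card (L' \<inter> {1..2 * r})" if "r \<le> m" for r
  proof (cases "b \<le> 2 * r")
    case True
    then have "L' \<inter> {1..2 * r} = L'"
      using b(2) L(1) by (fastforce simp: L'_def)
    then show ?thesis
      using cL' that by simp
  next
    case False
    then have "L' \<inter> {1..2 * r} = L \<inter> {1..2 * r}"
      by (auto simp: L'_def)
    then show ?thesis
      using r[of r] that by simp
  qed
  \<comment> \<open>The bound for \<open>r = m\<close> already accounts for all \<open>m\<close>
    elements of \<open>L'\<close>.\<close>
  have "L' \<inter> {1..2 * m} = L'"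
    by (rule card_seteq) (use fin low[of m] cL' in \<open>auto simp: L'_def\<close>)
  then have "L' \<in> lawn_sets m"
    using cL' low by (auto simp: lawn_sets_def)
  then have t: "tennis m ({1..2 * m} - L') L'"
    by (rule Suc.IH)
  have L'sub: "L' \<subseteq> {1..2 * m}"
    using \<open>L' \<in> lawn_sets m\<close> by (simp add: lawn_sets_def)
  have int: "{1..2 * Suc m} = {1..2 * m} \<union> {2 * m + 1, 2 * m + 2}"
    by auto
  have bL: "L = insert b L'" "b \<notin> L'"
    using b(1) by (auto simp: L'_def)
  have bin: "b \<in> ({1..2 * m} - L') \<union> {2 * m + 1, 2 * m + 2}"
    using L(1) bL int by blast
  have "{2 * m + 1, 2 * m + 2} \<inter> L' = {}"
    using L'sub by auto
  then have "{1..2 * m} - L' \<union> {2 * m + 1, 2 * m + 2} - {b} = {1..2 * Suc m} - L"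
    unfolding int bL(1) by blast
  then show ?case
    using tennis.round[OF t bin] bL(1) by simp
qed

lemma TB_eq_lawn_sets: "TB m = lawn_sets m"
  unfolding TB_def using tennis_imp_lawn_sets lawn_sets_imp_tennis by blast

section \<open>Bijection between Dyck paths and lawn configurations\<close>

lemma ups_map_upt: "L \<subseteq> {..<n} \<Longrightarrow> ups (map (\<lambda>j. j \<in> L) [0..<n]) = L"
  by (auto simp: ups_def)

lemma zero_in_ups_dyck_path:
  assumes "p \<in> dyck_paths (Suc m)"
  shows "0 \<in> ups p"
proof (rule ccontr)
  assume "0 \<notin> ups p"
  then have "ups p \<inter> {..<1} = {}"
    by auto
  moreover have "1 \<le> 2 * card (ups p \<inter> {..<1})"
    using assms by (auto simp: dyck_paths_iff dest: spec[of _ "1"])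
  ultimately show False
    by simp
qed

lemma ups_in_lawn_sets:
  assumes "p \<in> dyck_paths (Suc m)"
  shows "ups p - {0} \<in> lawn_sets m"
proof -
  define L where "L = ups p - {0}"
  have p: "length p = 2 * Suc m" "card (ups p) = Suc m"
    "\<And>n. n \<le> 2 * Suc m \<Longrightarrow> n \<le> 2 * card (ups p \<inter> {..<n})"
    using assms by (auto simp: dyck_paths_iff)
  have L: "ups p = insert 0 L" "0 \<notin> L" "finite L"
    using zero_in_ups_dyck_path[OF assms] by (auto simp: L_def)
  have cL: "card L = m"
    using p(2) L by simp
  have low: "r \<le> card (L \<inter> {1..2 * r})" if "r \<le> m" for r
  proof -
    \<comment> \<open>A prefix of odd length \<open>2 * r + 1\<close> needs at least
      \<open>r + 1\<close> up steps; one of them is at position 0, which leaves \<open>r\<close> for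
      \<open>L\<close>.\<close>
    have "ups p \<inter> {..<2 * r + 1} = insert 0 (L \<inter> {1..2 * r})"
      using L(1,2) by (auto simp: Suc_le_eq intro!: gr0I)
    then show ?thesis
      using p(3)[of "2 * r + 1"] that by simp
  qed
  have "L \<inter> {1..2 * m} = L"
    by (rule card_seteq) (use L low[of m] cL in auto)
  then show ?thesis
    using cL low by (auto simp: lawn_sets_def L_def)
qed

lemma lawn_set_in_dyck_paths:
  assumes "L \<in> lawn_sets m"
  shows "map (\<lambda>j. j \<in> insert 0 L) [0..<2 * Suc m] \<in> dyck_paths (Suc m)"
proof -
  have L: "L \<subseteq> {1..2 * m}" "card L = m" "\<And>r. r \<le> m \<Longrightarrow> r \<le> card (L \<inter> {1..2 * r})"
    using assms by (auto simp: lawn_sets_def)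
  have fin: "finite L"
    using L(1) finite_subset by blast
  have "0 \<notin> L"
    using L(1) by auto
  have "n \<le> 2 * card (insert 0 L \<inter> {..<n})" if "n \<le> 2 * Suc m" for n
  proof (cases n)
    case (Suc n')
    \<comment> \<open>The largest odd number up to \<open>n\<close> is \<open>2 * r + 1\<close>, and
      \<open>n\<close> is at most one more. So the bound \<open>Suc r\<close> from the odd prefix
      also suffices for \<open>n\<close>.\<close>
    define r where "r = n' div 2"
    have r: "r \<le> m" "n \<le> 2 * Suc r" "2 * r < n"
      using that Suc by (auto simp: r_def)
    have "Suc r \<le> card (insert 0 (L \<inter> {1..2 * r}))"
      using L(3)[OF r(1)] fin by simp
    also have "\<dots> \<le> card (insert 0 L \<inter> {..<n})"
      by (rule card_mono) (use r in auto)
    finally show ?thesis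
      using r(2) by simp
  qed simp
  moreover have "ups (map (\<lambda>j. j \<in> insert 0 L) [0..<2 * Suc m]) = insert 0 L"
    by (rule ups_map_upt) (use L(1) in auto)
  moreover have "card (insert 0 L) = Suc m"
    using fin \<open>0 \<notin> L\<close> L(2) by simp
  ultimately show ?thesis
    unfolding dyck_paths_iff by (metis length_map length_upt diff_zero)
qed

lemma sum_ups_dyck_paths: "(\<Sum>p\<in>dyck_paths (Suc m). \<Sum>j\<in>ups p. j) = tb m"
  unfolding tb_def TB_eq_lawn_sets
proof (rule sum.reindex_bij_witness[where
      i = "\<lambda>L. map (\<lambda>j. j \<in> insert 0 L) [0..<2 * Suc m]" and j = "\<lambda>p. ups p - {0}"])
  fix p
  assume p: "p \<in> dyck_paths (Suc m)"
  then have "insert 0 (ups p - {0}) = ups p" and len: "length p = 2 * Suc m"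
    using zero_in_ups_dyck_path by (auto simp: dyck_paths_iff)
  moreover have "map (\<lambda>j. j \<in> ups p) [0..<2 * Suc m] = p"
    unfolding len[symmetric] by (rule nth_equalityI) (simp_all add: ups_def)
  ultimately show "map (\<lambda>j. j \<in> insert 0 (ups p - {0})) [0..<2 * Suc m] = p"
    by (simp only:)
  show "ups p - {0} \<in> lawn_sets m"
    using p by (rule ups_in_lawn_sets)
  \<comment> \<open>Position 0 contributes nothing to the sum.\<close>
  show "\<Sum> (ups p - {0}) = \<Sum> (ups p)"
    by (rule sum.mono_neutral_left) auto
next
  fix L
  assume L: "L \<in> lawn_sets m"
  then show "map (\<lambda>j. j \<in> insert 0 L) [0..<2 * Suc m] \<in> dyck_paths (Suc m)"
    by (rule lawn_set_in_dyck_paths)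
  have "L \<subseteq> {1..2 * m}"
    using L by (simp add: lawn_sets_def)
  then have "insert 0 L \<subseteq> {..<2 * Suc m}" "0 \<notin> L"
    by auto
  then show "ups (map (\<lambda>j. j \<in> insert 0 L) [0..<2 * Suc m]) - {0} = L"
    by (subst ups_map_upt) auto
qed

theorem proposition5p4:
  fixes k :: nat
  assumes "k \<ge> 1"
  shows "Duck k 1 = tb (k - 1)"
  using assms Duck_1_eq[of k] sum_ups_dyck_paths[of "k - 1"] by simp

end
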